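(* Let $\mu\in M(\mathbb{T}^d)$ and let $\Lambda\subseteq\mathbb{Z}^d$ be a finite subset. Suppose there exists $\varphi\in U(\mathbb{T}^d;\Lambda)$ such that $|\varphi|\equiv 1$ on $\mathbb{T}^d$ and $\langle\varphi,\mu\rangle=\varepsilon(\mu,\Lambda)$. Then $\Gamma(\mu,\Lambda)\neq\emptyset$ and $\varepsilon(\mu,\Lambda)=\|\widehat\mu\|_{\ell^\infty(\Lambda)}$.
   Context: $\mathbb{T}^d=(\mathbb{R}/\mathbb{Z})^d$, and $M(\mathbb{T}^d)$ is the space of complex bounded Radon measures on $\mathbb{T}^d$ with the total variation norm $\|\cdot\|$. For $\mu\in M(\mathbb{T}^d)$ and $m\in\mathbb{Z}^d$, $\widehat\mu(m)=\int_{\mathbb{T}^d}e^{-2\pi i m\cdot x}\,d\mu(x)$, and $\|\widehat\mu\|_{\ell^\infty(\Lambda)}=\sup_{m\in\Lambda}|\widehat\mu(m)|$. For continuous $f\colon\mathbb{T}^d\to\mathbb{C}$, $\langle f,\mu\rangle=\int_{\mathbb{T}^d}f(x)\,\overline{d\mu(x)}$. $\varepsilon(\mu,\Lambda)=\min\{\|\nu\|\colon\nu\in M(\mathbb{T}^d),\ \widehat\nu=\widehat\mu\text{ on }\Lambda\}$ (the minimum is attained), and $\Gamma(\mu,\Lambda)=\{m\in\Lambda\colon|\widehat\mu(m)|=\varepsilon(\mu,\Lambda)\}$. $U(\mathbb{T}^d;\Lambda)$ is the set of functions $f(x)=\sum_{m\in\Lambda}a_me^{2\pi i m\cdot x}$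 on $\mathbb{T}^d$, with $a_m\in\mathbb{C}$, satisfying $\|f\|_\infty\leq 1$. *)

theory Defs
  imports "HOL-Analysis.Analysis"
begin

subsection \<open>The torus\<close>

quotient_type circle = real / "\<lambda>x y :: real. x - y \<in> \<int>"
proof (rule equivpI)
  show "reflp (\<lambda>x y :: real. x - y \<in> \<int>)"
    by (simp add: reflp_def)
  show "symp (\<lambda>x y :: real. x - y \<in> \<int>)"
    by (metis (no_types, lifting) Ints_minus minus_diff_eq sympI)
  show "transp (\<lambda>x y :: real. x - y \<in> \<int>)"
    by (rule transpI) (metis Ints_add diff_add_cancel add_diff_eq)
qed

text \<open>\<^term>\<open>abs_circle\<close> is the projection from the reals onto the circle, and the circle carries the
  quotient topology. The torus is the type \<open>circle ^ 'd\<close>, which the library equips with the product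
  topology.\<close>

instantiation circle :: topological_space
begin

definition open_circle :: "circle set \<Rightarrow> bool" where
  "open_circle S \<longleftrightarrow> open (abs_circle -` S)"

instance
proof
  show "open (UNIV :: circle set)"
    by (simp add: open_circle_def)
  show "open (S \<inter> T)" if "open S" "open T" for S T :: "circle set"
    using that by (simp add: open_circle_def vimage_Int open_Int)
  show "open (\<Union>K)" if "\<forall>S\<in>K. open S" for K :: "circle set set"
    using that by (simp add: open_circle_def vimage_Union open_UN)
qed

end

type_synonym 'd torus = "circle ^ 'd"

definition character :: "int ^ 'd \<Rightarrow> 'd torus \<Rightarrow> complex" where
  "character m x = exp (2 * pi * \<i> * (\<Sum>i\<in>UNIV. of_int (m $ i) * of_real (rep_circle (x $ i))))"

text \<open>The value does not depend on the representatives chosen by \<^term>\<open>rep_circle\<close>.\<close>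

lemma character_abs_circle:
  fixes m :: "int ^ 'd" and x :: "real ^ 'd"
  shows "character m (\<chi> i. abs_circle (x $ i))
    = exp (2 * pi * \<i> * (\<Sum>i\<in>UNIV. of_int (m $ i) * of_real (x $ i)))"
proof -
  have "\<exists>k. rep_circle (abs_circle (x $ i)) = x $ i + of_int k" for i
  proof -
    have "rep_circle (abs_circle (x $ i)) - x $ i \<in> \<int>"
      using Quotient3_rep_abs[OF Quotient3_circle, of "x $ i"] by simp
    then show ?thesis
      by (metis Ints_cases add.commute diff_add_cancel)
  qed
  then obtain k where k: "\<And>i. rep_circle (abs_circle (x $ i)) = x $ i + of_int (k i)"
    by metis
  let ?n = "\<Sum>i\<in>UNIV. m $ i * k i"
  have "character m (\<chi> i. abs_circle (x $ i))
    = exp (2 * pi * \<i> * (\<Sum>i\<in>UNIV. of_int (m $ i) * of_real (x $ i)) + of_int (2 * ?n) * pi * \<i>)"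
    unfolding character_def
    by (simp add: k sum.distrib algebra_simps flip: sum_distrib_left)
  moreover have "exp (of_int (2 * ?n) * pi * \<i>) = 1"
    using exp_integer_2pi[OF Ints_of_int, of ?n] by simp
  ultimately show ?thesis
    by (simp only: exp_add mult_1_right)
qed

subsection \<open>Complex Radon measures\<close>

definition variation :: "('a::topological_space set \<Rightarrow> 'b::real_normed_vector) \<Rightarrow> 'a set \<Rightarrow> ennreal" where
  "variation \<mu> E = (SUP A \<in> {A :: nat \<Rightarrow> 'a set.
      range A \<subseteq> sets borel \<and> disjoint_family A \<and> (\<Union>i. A i) = E}.
    \<Sum>i. ennreal (norm (\<mu> (A i))))"

definition tv_norm :: "('a::topological_space set \<Rightarrow> complex) \<Rightarrow> real" where
  "tv_norm \<mu> = enn2real (variation \<mu> UNIV)"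

text \<open>A measure is represented by a function on all sets, of which only the values on Borel sets
  matter. The three conjuncts are countable additivity, boundedness and regularity.
  Countable additivity applied to the constant family of empty sets gives \<open>\<mu> {} = 0\<close>.\<close>

definition radon_measures :: "('a::topological_space set \<Rightarrow> complex) set" where
  "radon_measures = {\<mu>.
    (\<forall>A :: nat \<Rightarrow> 'a set. range A \<subseteq> sets borel \<longrightarrow> disjoint_family A \<longrightarrow>
        (\<lambda>i. \<mu> (A i)) sums \<mu> (\<Union>i. A i)) \<and>
    variation \<mu> UNIV < \<infinity> \<and>
    (\<forall>B \<in> sets borel. \<forall>\<delta>>0. \<exists>K V. compact K \<and> K \<in> sets borel \<and> open V \<and> K \<subseteq> B \<and> B \<subseteq> V \<and>
        variation \<mu> (V - K) < \<delta>)}"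

text \<open>The positive part \<open>(\<bar>\<nu>\<bar> + \<nu>) / 2\<close> in the Jordan decomposition of a finite signed measure.
  The negative part of \<open>\<nu>\<close> is the positive part of \<open>-\<nu>\<close>.\<close>

definition positive_part :: "('a::topological_space set \<Rightarrow> real) \<Rightarrow> 'a measure" where
  "positive_part \<nu> =
    measure_of UNIV (sets borel) (\<lambda>A. ennreal ((enn2real (variation \<nu> A) + \<nu> A) / 2))"

definition signed_integral :: "('a::topological_space set \<Rightarrow> real) \<Rightarrow> ('a \<Rightarrow> complex) \<Rightarrow> complex" where
  "signed_integral \<nu> f =
    integral\<^sup>L (positive_part \<nu>) f - integral\<^sup>L (positive_part (\<lambda>A. - \<nu> A)) f"

definition complex_integral :: "('a::topological_space set \<Rightarrow> complex) \<Rightarrow> ('a \<Rightarrow> complex) \<Rightarrow> complex" where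
  "complex_integral \<mu> f =
    signed_integral (\<lambda>A. Re (\<mu> A)) f + \<i> * signed_integral (\<lambda>A. Im (\<mu> A)) f"

definition pairing :: "('a::topological_space \<Rightarrow> complex) \<Rightarrow> ('a set \<Rightarrow> complex) \<Rightarrow> complex" where
  "pairing f \<mu> = complex_integral (\<lambda>A. cnj (\<mu> A)) f"

subsection \<open>Fourier coefficients and minimal extrapolation\<close>

definition fourier_coeff :: "('d torus set \<Rightarrow> complex) \<Rightarrow> int ^ 'd \<Rightarrow> complex" where
  "fourier_coeff \<mu> m = complex_integral \<mu> (character (- m))"

definition linf_norm :: "'i set \<Rightarrow> ('i \<Rightarrow> complex) \<Rightarrow> real" where
  "linf_norm S c = (SUP m\<in>S. cmod (c m))"

text \<open>The infimum is a minimum: it is attained.\<close>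

definition min_norm :: "('d torus set \<Rightarrow> complex) \<Rightarrow> (int ^ 'd) set \<Rightarrow> real" where
  "min_norm \<mu> \<Lambda> =
    Inf {tv_norm \<nu> | \<nu>. \<nu> \<in> radon_measures \<and> (\<forall>m\<in>\<Lambda>. fourier_coeff \<nu> m = fourier_coeff \<mu> m)}"

definition extremal_freqs :: "('d torus set \<Rightarrow> complex) \<Rightarrow> (int ^ 'd) set \<Rightarrow> (int ^ 'd) set" where
  "extremal_freqs \<mu> \<Lambda> = {m \<in> \<Lambda>. cmod (fourier_coeff \<mu> m) = min_norm \<mu> \<Lambda>}"

text \<open>Used for finite \<open>\<Lambda>\<close> only.\<close>

definition trig_polys_unit :: "(int ^ 'd) set \<Rightarrow> ('d torus \<Rightarrow> complex) set" where
  "trig_polys_unit \<Lambda> =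
    {f. (\<exists>a. f = (\<lambda>x. \<Sum>m\<in>\<Lambda>. a m * character m x)) \<and> linf_norm UNIV f \<le> 1}"

end

theory Submission
  imports Defs "HOL-Computational_Algebra.Polynomial"
begin

text \<open>
  The hypothesis on \<open>\<phi>\<close> is very restrictive: a trigonometric polynomial of constant modulus 1 is a
  single monomial \<open>c * character l\<close> with \<open>l \<in> \<Lambda>\<close> and \<open>\<bar>c\<bar> = 1\<close> (\<open>unimodular_trig_poly_monomial\<close>).
  Indeed \<open>\<phi> * cnj \<phi> = 1\<close>, while the product of the lowest term of \<open>\<phi>\<close> with the conjugate of the
  highest one, for a suitable linear order on the frequencies, is not cancelled by any other product
  of terms; so these two terms coincide. Hence \<open>\<langle>\<phi>, \<mu>\<rangle>\<close> is \<open>c\<close> times the conjugate of the Fourier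
  coefficient of \<open>\<mu>\<close> at \<open>l\<close> (\<open>pairing_character\<close>), and the frequency \<open>l\<close> attains \<open>\<epsilon>(\<mu>, \<Lambda>)\<close>.

  Conversely, no Fourier coefficient on \<open>\<Lambda>\<close> exceeds \<open>\<epsilon>(\<mu>, \<Lambda>)\<close>: it is shared by every extrapolation \<open>\<nu>\<close>,
  and a Fourier coefficient of \<open>\<nu>\<close> is at most the total variation of \<open>\<nu>\<close>
  (\<open>norm_fourier_coeff_le_tv_norm\<close>). So \<open>l\<close> attains the supremum over \<open>\<Lambda>\<close> as well.

  Most of the work is the last inequality, with constant exactly 1, for an integral that is
  assembled from the Jordan decompositions of the real and the imaginary part. The variation is
  a measure, so the positive parts are measures and their differences give back \<open>\<mu>\<close>; the bound
  is then evident on simple functions and passes to the limit (\<open>norm_complex_integral_le\<close>).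
\<close>

section \<open>Countable additivity of the variation\<close>

definition borel_partitions :: "'a::topological_space set \<Rightarrow> (nat \<Rightarrow> 'a set) set" where
  "borel_partitions E = {A. range A \<subseteq> sets borel \<and> disjoint_family A \<and> (\<Union>i. A i) = E}"

text \<open>The part of \<^const>\<open>radon_measures\<close> that integration needs, for arbitrary value spaces so that it
  applies to a complex measure and to its real and imaginary parts.\<close>

definition bounded_vector_measure :: "('a::topological_space set \<Rightarrow> 'b::real_normed_vector) \<Rightarrow> bool" where
  "bounded_vector_measure \<mu> \<longleftrightarrow>
    (\<forall>A :: nat \<Rightarrow> 'a set. range A \<subseteq> sets borel \<longrightarrow> disjoint_family A \<longrightarrow>
        (\<lambda>i. \<mu> (A i)) sums \<mu> (\<Union>i. A i)) \<and>
    variation \<mu> UNIV < \<infinity>"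

lemma radon_imp_bounded_vector_measure:
  "\<mu> \<in> radon_measures \<Longrightarrow> bounded_vector_measure \<mu>"
  by (simp add: radon_measures_def bounded_vector_measure_def)

lemma bounded_vector_measure_sums:
  fixes A :: "nat \<Rightarrow> 'a::topological_space set"
  shows "bounded_vector_measure \<mu> \<Longrightarrow> range A \<subseteq> sets borel \<Longrightarrow> disjoint_family A \<Longrightarrow>
    (\<lambda>i. \<mu> (A i)) sums \<mu> (\<Union>i. A i)"
  unfolding bounded_vector_measure_def by (elim conjE allE[of _ A]) simp

lemma variation_altdef:
  "variation \<mu> E = (SUP A\<in>borel_partitions E. \<Sum>i. ennreal (norm (\<mu> (A i))))"
  unfolding variation_def borel_partitions_def ..

lemma partition_sum_le_variation:
  "A \<in> borel_partitions E \<Longrightarrow> (\<Sum>i. ennreal (norm (\<mu> (A i)))) \<le> variation \<mu> E"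
  unfolding variation_altdef by (rule SUP_upper)

lemma case_nat_partition:
  assumes "A \<in> borel_partitions E" "B \<in> sets borel" "B \<inter> E = {}"
  shows "case_nat B A \<in> borel_partitions (B \<union> E)"
proof -
  have dj: "disjoint_family A" and sA: "\<And>i. A i \<in> sets borel" and U: "(\<Union>i. A i) = E"
    using assms(1) by (auto simp: borel_partitions_def)
  have "range (case_nat B A) \<subseteq> sets borel"
    using sA assms(2) by (auto split: nat.split)
  moreover have "disjoint_family (case_nat B A)"
    unfolding disjoint_family_on_def
  proof (intro ballI impI)
    fix m n :: nat assume "m \<noteq> n"
    then show "case_nat B A m \<inter> case_nat B A n = {}"
      using dj U assms(3) unfolding disjoint_family_on_def
      by (cases m; cases n) (simp, simp, blast, simp, blast, simp)
  qed
  moreover have "(\<Union>i. case_nat B A i) = B \<union> E"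
  proof -
    have "x \<in> (\<Union>i. case_nat B A i) \<longleftrightarrow> x \<in> B \<or> (\<exists>i. x \<in> A i)" for x
      by (metis UN_iff UNIV_I nat.case(1) nat.case(2) not0_implies_Suc)
    then show ?thesis using U by blast
  qed
  ultimately show ?thesis by (simp add: borel_partitions_def)
qed

lemma suminf_case_nat:
  fixes f :: "'a \<Rightarrow> ennreal"
  shows "(\<Sum>i. f (case_nat b a i)) = f b + (\<Sum>i. f (a i))"
proof -
  have "(\<lambda>i. f (case_nat b a (Suc i))) sums (\<Sum>i. f (a i))"
    by (simp add: summable_sums summableI)
  from sums_Suc[OF this] show ?thesis
    by (simp add: sums_iff add.commute)
qed

lemma sets_borel_of_partition: "A \<in> borel_partitions E \<Longrightarrow> E \<in> sets borel"
  unfolding borel_partitions_def by auto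

text \<open>Any partition of \<open>E\<close> becomes a partition of \<open>F\<close> on adding the piece \<open>F - E\<close>, and the new piece
  can only increase the sum.\<close>

lemma variation_mono:
  assumes "E \<subseteq> F" "F \<in> sets borel"
  shows "variation \<mu> E \<le> variation \<mu> F"
  unfolding variation_altdef[of \<mu> E]
proof (rule SUP_least)
  fix A assume A: "A \<in> borel_partitions E"
  have "case_nat (F - E) A \<in> borel_partitions ((F - E) \<union> E)"
    using assms sets_borel_of_partition[OF A] by (intro case_nat_partition[OF A]) auto
  also have "(F - E) \<union> E = F" using assms by auto
  finally have le: "(\<Sum>i. ennreal (norm (\<mu> (case_nat (F - E) A i)))) \<le> variation \<mu> F"
    by (rule partition_sum_le_variation)
  have "(\<Sum>i. ennreal (norm (\<mu> (A i)))) \<le> ennreal (norm (\<mu> (F - E))) + (\<Sum>i. ennreal (norm (\<mu> (A i))))"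
    by simp
  also note suminf_case_nat[of "\<lambda>X. ennreal (norm (\<mu> X))", symmetric]
  also note le
  finally show "(\<Sum>i. ennreal (norm (\<mu> (A i)))) \<le> variation \<mu> F" .
qed

lemma trivial_partition: "E \<in> sets borel \<Longrightarrow> case_nat E (\<lambda>_. {}) \<in> borel_partitions E"
  using case_nat_partition[of "\<lambda>_. {}" "{}" E] by (simp add: borel_partitions_def disjoint_family_on_def)

text \<open>The set itself, followed by empty sets, is one of the partitions in the supremum.\<close>

lemma norm_le_variation:
  assumes "E \<in> sets borel"
  shows "ennreal (norm (\<mu> E)) \<le> variation \<mu> E"
proof -
  have "ennreal (norm (\<mu> E)) \<le> (\<Sum>i. ennreal (norm (\<mu> (case_nat E (\<lambda>_. {}) i))))"
    by (subst suminf_case_nat[of "\<lambda>X. ennreal (norm (\<mu> X))"]) simp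
  also have "\<dots> \<le> variation \<mu> E"
    by (rule partition_sum_le_variation[OF trivial_partition[OF assms]])
  finally show ?thesis .
qed

lemma variation_finite:
  "bounded_vector_measure \<mu> \<Longrightarrow> variation \<mu> E < \<infinity>"
  using variation_mono[of E UNIV \<mu>] unfolding bounded_vector_measure_def
  by (simp add: le_less_trans)

lemma norm_le_enn2real_variation:
  assumes \<mu>: "bounded_vector_measure \<mu>" and "E \<in> sets borel"
  shows "norm (\<mu> E) \<le> enn2real (variation \<mu> E)"
  using enn2real_mono[OF norm_le_variation[OF assms(2), of \<mu>]] variation_finite[OF \<mu>, of E] by simp

lemma norm_sums_le:
  fixes f :: "nat \<Rightarrow> 'b::real_normed_vector"
  assumes "f sums s"
  shows "ennreal (norm s) \<le> (\<Sum>i. ennreal (norm (f i)))"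
proof (rule LIMSEQ_le_const2)
  show "(\<lambda>n. ennreal (norm (\<Sum>i<n. f i))) \<longlonglongrightarrow> ennreal (norm s)"
    using assms unfolding sums_def by (intro tendsto_intros)
  show "\<exists>N. \<forall>n\<ge>N. ennreal (norm (\<Sum>i<n. f i)) \<le> (\<Sum>i. ennreal (norm (f i)))"
  proof (intro exI allI impI)
    fix n
    have "ennreal (norm (\<Sum>i<n. f i)) \<le> ennreal (\<Sum>i<n. norm (f i))"
      by (intro ennreal_leI norm_sum)
    also have "\<dots> = (\<Sum>i<n. ennreal (norm (f i)))" by simp
    also have "\<dots> \<le> (\<Sum>i. ennreal (norm (f i)))"
      by (rule sum_le_suminf) auto
    finally show "ennreal (norm (\<Sum>i<n. f i)) \<le> (\<Sum>i. ennreal (norm (f i)))" .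
  qed
qed

lemma suminf_swap_ennreal:
  fixes f :: "nat \<Rightarrow> nat \<Rightarrow> ennreal"
  shows "(\<Sum>i. \<Sum>j. f i j) = (\<Sum>j. \<Sum>i. f i j)"
  using nn_integral_suminf[of "\<lambda>i. f i" "count_space UNIV"]
  by (simp add: nn_integral_count_space_nat)

text \<open>Intersecting a partition \<open>A\<close> of the whole set with the pieces \<open>F j\<close> refines it. Refining
  increases the sum by the triangle inequality, and the refined sum, taken first over \<open>A\<close>,
  is a partition sum for each \<open>F j\<close>.\<close>

lemma variation_countably_subadditive:
  assumes add: "\<And>A. range A \<subseteq> sets borel \<Longrightarrow> disjoint_family A \<Longrightarrow> (\<lambda>i. \<mu> (A i)) sums \<mu> (\<Union>i::nat. A i)"
    and E: "F \<in> borel_partitions E"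
  shows "variation \<mu> E \<le> (\<Sum>j. variation \<mu> (F j))"
  unfolding variation_altdef[of \<mu> E]
proof (rule SUP_least)
  fix A assume A: "A \<in> borel_partitions E"
  have "(\<Sum>i. ennreal (norm (\<mu> (A i)))) \<le> (\<Sum>i. \<Sum>j. ennreal (norm (\<mu> (A i \<inter> F j))))"
  proof (intro suminf_le summableI)
    fix i
    have "disjoint_family F" using E by (simp add: borel_partitions_def)
    then have dF: "disjoint_family (\<lambda>j. A i \<inter> F j)"
      by (rule disjoint_family_subset) simp
    have "(\<lambda>j. \<mu> (A i \<inter> F j)) sums \<mu> (\<Union>j. A i \<inter> F j)"
    proof (rule add)
      show "range (\<lambda>j. A i \<inter> F j) \<subseteq> sets borel" using A E by (auto simp: borel_partitions_def)
      show "disjoint_family (\<lambda>j. A i \<inter> F j)" by (rule dF)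
    qed
    moreover have "(\<Union>j. A i \<inter> F j) = A i"
      using A E by (auto simp: borel_partitions_def)
    ultimately show "ennreal (norm (\<mu> (A i))) \<le> (\<Sum>j. ennreal (norm (\<mu> (A i \<inter> F j))))"
      by (metis norm_sums_le)
  qed
  also have "\<dots> = (\<Sum>j. \<Sum>i. ennreal (norm (\<mu> (A i \<inter> F j))))"
    by (rule suminf_swap_ennreal)
  also have "\<dots> \<le> (\<Sum>j. variation \<mu> (F j))"
  proof (intro suminf_le summableI partition_sum_le_variation)
    fix j
    have "range (\<lambda>i. A i \<inter> F j) \<subseteq> sets borel" "(\<Union>i. A i \<inter> F j) = F j"
      using A E by (auto simp: borel_partitions_def)
    moreover have "disjoint_family A" using A by (simp add: borel_partitions_def)
    then have "disjoint_family (\<lambda>i. A i \<inter> F j)"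
      by (rule disjoint_family_subset) simp
    ultimately show "(\<lambda>i. A i \<inter> F j) \<in> borel_partitions (F j)"
      by (simp add: borel_partitions_def)
  qed
  finally show "(\<Sum>i. ennreal (norm (\<mu> (A i)))) \<le> (\<Sum>j. variation \<mu> (F j))" .
qed

text \<open>Near-optimal partitions of the pieces \<open>F j\<close>, with errors \<open>e / 2\<^sup>j\<^sup>+\<^sup>1\<close> that add up to \<open>e\<close>, combine
  along the enumeration of pairs to a single partition of the whole set.\<close>

lemma variation_countably_superadditive:
  assumes E: "F \<in> borel_partitions E"
  shows "(\<Sum>j. variation \<mu> (F j)) \<le> variation \<mu> E"
proof (rule ennreal_le_epsilon)
  fix e :: real
  assume fin: "variation \<mu> E < top" and e: "0 < e"
  have "\<exists>P. P \<in> borel_partitions (F j) \<and>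
    variation \<mu> (F j) \<le> (\<Sum>i. ennreal (norm (\<mu> (P i)))) + ennreal (e * (1/2) ^ Suc j)" for j
  proof -
    have Fj: "F j \<in> sets borel" "F j \<subseteq> E" using E by (auto simp: borel_partitions_def)
    have "variation \<mu> (F j) \<noteq> \<infinity>"
      using variation_mono[OF Fj(2) sets_borel_of_partition[OF E], of \<mu>] fin by auto
    moreover have "borel_partitions (F j) \<noteq> {}" using trivial_partition[OF Fj(1)] by auto
    ultimately obtain P where "P \<in> borel_partitions (F j)"
      "variation \<mu> (F j) < (\<Sum>i. ennreal (norm (\<mu> (P i)))) + ennreal (e * (1/2) ^ Suc j)"
      using SUP_approx_ennreal[of "e * (1/2) ^ Suc j" _ _ "\<lambda>P. \<Sum>i. ennreal (norm (\<mu> (P i)))"] e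
        variation_altdef[of \<mu> "F j"] by (metis half_gt_zero_iff mult_pos_pos zero_less_one zero_less_power)
    then show ?thesis by (auto intro: less_imp_le)
  qed
  then obtain P where P: "\<And>j. P j \<in> borel_partitions (F j)"
    and le: "\<And>j. variation \<mu> (F j) \<le> (\<Sum>i. ennreal (norm (\<mu> (P j i)))) + ennreal (e * (1/2) ^ Suc j)"
    by metis
  have P1: "P j i \<in> sets borel" and P2: "disjoint_family (P j)" and P3: "(\<Union>i. P j i) = F j" for i j
    using P[of j] by (auto simp: borel_partitions_def)
  define Q where "Q k = case_prod P (prod_decode k)" for k
  have "Q \<in> borel_partitions E"
  proof -
    have "range Q \<subseteq> sets borel" using P1 by (auto simp: Q_def split: prod.split)
    moreover have "disjoint_family Q"
      unfolding disjoint_family_on_def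
    proof (intro ballI impI)
      fix m n :: nat assume "m \<noteq> n"
      obtain a b c d where ab: "prod_decode m = (a, b)" and cd: "prod_decode n = (c, d)"
        by (metis surj_pair)
      have ne: "(a, b) \<noteq> (c, d)" using \<open>m \<noteq> n\<close> ab cd by (metis prod_decode_inverse)
      have "P a b \<inter> P c d = {}"
      proof (cases "a = c")
        case True
        then show ?thesis using ne P2[of a] by (auto simp: disjoint_family_on_def)
      next
        case False
        then have "F a \<inter> F c = {}" using E by (auto simp: borel_partitions_def disjoint_family_on_def)
        then show ?thesis using P3[of a] P3[of c] by blast
      qed
      then show "Q m \<inter> Q n = {}" by (simp add: Q_def ab cd)
    qed
    moreover have "(\<Union>k. Q k) = E"
    proof -
      have "x \<in> (\<Union>k. Q k) \<longleftrightarrow> x \<in> (\<Union>j. \<Union>i. P j i)" for x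
      proof
        assume "x \<in> (\<Union>k. Q k)"
        then show "x \<in> (\<Union>j. \<Union>i. P j i)" by (force simp: Q_def case_prod_beta)
      next
        assume "x \<in> (\<Union>j. \<Union>i. P j i)"
        then obtain j i where "x \<in> P j i" by blast
        then have "x \<in> Q (prod_encode (j, i))" by (simp add: Q_def)
        then show "x \<in> (\<Union>k. Q k)" by blast
      qed
      then have "(\<Union>k. Q k) = (\<Union>j. \<Union>i. P j i)" by blast
      also have "\<dots> = E" using P3 E by (auto simp: borel_partitions_def)
      finally show ?thesis .
    qed
    ultimately show ?thesis by (simp add: borel_partitions_def)
  qed
  then have Qle: "(\<Sum>k. ennreal (norm (\<mu> (Q k)))) \<le> variation \<mu> E"
    by (rule partition_sum_le_variation)
  have geo: "(\<Sum>j. ennreal (e * (1/2) ^ Suc j)) = ennreal e"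
    using sums_mult[OF power_half_series, of e] e by (intro suminf_ennreal_eq) auto
  have "(\<Sum>j. variation \<mu> (F j)) \<le> (\<Sum>j. (\<Sum>i. ennreal (norm (\<mu> (P j i)))) + ennreal (e * (1/2) ^ Suc j))"
    by (intro suminf_le summableI le)
  also have "\<dots> = (\<Sum>j. \<Sum>i. ennreal (norm (\<mu> (P j i)))) + ennreal e"
    by (subst suminf_add[symmetric]) (auto simp only: geo intro: summableI)
  also have "(\<Sum>j. \<Sum>i. ennreal (norm (\<mu> (P j i)))) = (\<Sum>k. ennreal (norm (\<mu> (Q k))))"
    unfolding Q_def
    by (subst suminf_ennreal_2dimen[of _ "\<lambda>p. ennreal (norm (\<mu> (case_prod P p)))", symmetric])
       auto
  also have "\<dots> + ennreal e \<le> variation \<mu> E + ennreal e"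
    using Qle by (rule add_right_mono)
  finally show "(\<Sum>j. variation \<mu> (F j)) \<le> variation \<mu> E + ennreal e" .
qed

section \<open>The variation measure and the Jordan decomposition\<close>

definition variation_measure :: "('a::topological_space set \<Rightarrow> 'b::real_normed_vector) \<Rightarrow> 'a measure" where
  "variation_measure \<mu> = measure_of UNIV (sets borel) (variation \<mu>)"

lemma empty_of_bounded_vector_measure:
  assumes "bounded_vector_measure \<mu>" shows "\<mu> {} = 0"
proof -
  have "(\<lambda>i::nat. \<mu> ((\<lambda>_. {}) i)) sums \<mu> (\<Union>i::nat. (\<lambda>_. {}) i)"
    by (rule bounded_vector_measure_sums[OF assms]) (auto simp: disjoint_family_on_def)
  from sums_summable[OF this] show ?thesis by (simp only: summable_const_iff)
qed

lemma sets_variation_measure [simp, measurable_cong]: "sets (variation_measure \<mu>) = sets borel"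
  unfolding variation_measure_def using sets.sigma_sets_eq[of borel]
  by (auto simp: sets_measure_of sets.space_closed)

lemma sigma_algebra_borel: "sigma_algebra UNIV (sets (borel :: 'a::topological_space measure))"
  using sets.sigma_algebra_axioms[of borel] by simp

text \<open>\<^const>\<open>measure_of\<close> returns the zero measure unless the set function given to it is
  countably additive, so this identity is where the additivity of the variation enters.\<close>

lemma emeasure_variation_measure:
  assumes \<mu>: "bounded_vector_measure \<mu>" and "A \<in> sets borel"
  shows "emeasure (variation_measure \<mu>) A = variation \<mu> A"
  unfolding variation_measure_def
proof (rule emeasure_measure_of_sigma[OF sigma_algebra_borel])
  have "borel_partitions {} = {\<lambda>_::nat. {} :: 'a set}"
    by (auto simp: borel_partitions_def disjoint_family_on_def)
  then show "positive (sets borel) (variation \<mu>)"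
    by (simp add: positive_def variation_altdef empty_of_bounded_vector_measure[OF \<mu>])
  show "countably_additive (sets borel) (variation \<mu>)"
  proof (rule countably_additiveI)
    fix F :: "nat \<Rightarrow> 'a set"
    assume "range F \<subseteq> sets borel" "disjoint_family F"
    then have F: "F \<in> borel_partitions (\<Union>i. F i)" by (simp add: borel_partitions_def)
    show "(\<Sum>j. variation \<mu> (F j)) = variation \<mu> (\<Union>i. F i)"
      by (intro antisym variation_countably_superadditive[OF F]
          variation_countably_subadditive[OF bounded_vector_measure_sums[OF \<mu>] F])
  qed
qed fact

lemma measure_variation_measure:
  "bounded_vector_measure \<mu> \<Longrightarrow> A \<in> sets borel \<Longrightarrow>
    measure (variation_measure \<mu>) A = enn2real (variation \<mu> A)"
  by (simp add: measure_def emeasure_variation_measure)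

lemma finite_variation_measure:
  assumes "bounded_vector_measure \<mu>"
  shows "finite_measure (variation_measure \<mu>)"
  by (rule finite_measureI)
     (use assms variation_finite[OF assms, of UNIV] in
      \<open>simp add: emeasure_variation_measure sets_eq_imp_space_eq[OF sets_variation_measure]\<close>)

text \<open>Countable additivity of the variation and of \<open>\<nu>\<close> gives that of \<open>(\<bar>\<nu>\<bar> + \<nu>) / 2\<close>, and \<open>-\<nu> \<le> \<bar>\<nu>\<bar>\<close> makes
  it nonnegative, so that the truncation in \<^const>\<open>ennreal\<close> has no effect and the additivity survives.
  Otherwise \<^const>\<open>positive_part\<close> would be the zero measure and the integral would be meaningless.\<close>

lemma emeasure_positive_part:
  fixes \<nu> :: "'a::topological_space set \<Rightarrow> real"
  assumes \<nu>: "bounded_vector_measure \<nu>" and "A \<in> sets borel"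
  shows "emeasure (positive_part \<nu>) A = ennreal ((enn2real (variation \<nu> A) + \<nu> A) / 2)"
  unfolding positive_part_def
proof (rule emeasure_measure_of_sigma[OF sigma_algebra_borel])
  interpret V: finite_measure "variation_measure \<nu>"
    by (rule finite_variation_measure[OF \<nu>])
  note var = measure_variation_measure[OF \<nu>, symmetric]
  have nonneg: "0 \<le> enn2real (variation \<nu> A) + \<nu> A" if "A \<in> sets borel" for A
    using norm_le_enn2real_variation[OF \<nu> that] by (simp add: abs_le_iff)
  show "positive (sets borel) (\<lambda>A. ennreal ((enn2real (variation \<nu> A) + \<nu> A) / 2))"
    using var[of "{}"] by (simp add: positive_def empty_of_bounded_vector_measure[OF \<nu>])
  show "countably_additive (sets borel) (\<lambda>A. ennreal ((enn2real (variation \<nu> A) + \<nu> A) / 2))"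
  proof (rule countably_additiveI)
    fix F :: "nat \<Rightarrow> 'a set"
    assume F: "range F \<subseteq> sets borel" "disjoint_family F" "(\<Union>i. F i) \<in> sets borel"
    have "(\<lambda>i. measure (variation_measure \<nu>) (F i)) sums measure (variation_measure \<nu>) (\<Union>i. F i)"
      using F by (intro V.finite_measure_UNION) auto
    then have "(\<lambda>i. enn2real (variation \<nu> (F i))) sums enn2real (variation \<nu> (\<Union>i. F i))"
      using F var[of "F _"] by (simp add: var range_subsetD)
    moreover have "(\<lambda>i. \<nu> (F i)) sums \<nu> (\<Union>i. F i)"
      using \<nu> F(1,2) by (rule bounded_vector_measure_sums)
    ultimately have "(\<lambda>i. (enn2real (variation \<nu> (F i)) + \<nu> (F i)) / 2) sums
       ((enn2real (variation \<nu> (\<Union>i. F i)) + \<nu> (\<Union>i. F i)) / 2)"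
      by (intro sums_divide sums_add)
    then show "(\<Sum>i. ennreal ((enn2real (variation \<nu> (F i)) + \<nu> (F i)) / 2)) =
       ennreal ((enn2real (variation \<nu> (\<Union>i. F i)) + \<nu> (\<Union>i. F i)) / 2)"
      using F(1) nonneg by (intro suminf_ennreal_eq) auto
  qed
qed fact

lemma sets_positive_part [simp, measurable_cong]: "sets (positive_part \<nu>) = sets borel"
  unfolding positive_part_def using sets.sigma_sets_eq[of borel]
  by (auto simp: sets_measure_of sets.space_closed)

lemma space_positive_part [simp]: "space (positive_part \<nu>) = UNIV"
  using sets_eq_imp_space_eq[OF sets_positive_part[of \<nu>]] by simp

lemma finite_positive_part:
  assumes "bounded_vector_measure \<nu>"
  shows "finite_measure (positive_part \<nu>)"
  by (rule finite_measureI) (simp add: emeasure_positive_part[OF assms])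

text \<open>Covers real part, imaginary part and negation at once.\<close>

lemma bounded_vector_measure_contraction:
  assumes \<mu>: "bounded_vector_measure \<mu>" and T: "bounded_linear T" and le: "\<And>x. norm (T x) \<le> norm x"
  shows "bounded_vector_measure (\<lambda>A. T (\<mu> A))"
proof -
  have "variation (\<lambda>A. T (\<mu> A)) UNIV \<le> variation \<mu> UNIV"
    unfolding variation_altdef by (intro SUP_mono') (intro suminf_le summableI ennreal_leI le)
  then show ?thesis
    using \<mu> bounded_linear.sums[OF T] unfolding bounded_vector_measure_def
    by (auto intro: le_less_trans)
qed

lemma bounded_vector_measure_uminus:
  "bounded_vector_measure \<mu> \<Longrightarrow> bounded_vector_measure (\<lambda>A. - \<mu> A)"
  by (erule bounded_vector_measure_contraction[OF _ bounded_linear_minus[OF bounded_linear_ident]]) simp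

lemma variation_uminus: "variation (\<lambda>A. - \<mu> A) E = variation \<mu> E"
  unfolding variation_def by simp

lemma measure_positive_part_diff:
  assumes \<nu>: "bounded_vector_measure \<nu>" and A: "A \<in> sets borel"
  shows "measure (positive_part \<nu>) A - measure (positive_part (\<lambda>A. - \<nu> A)) A = \<nu> A"
proof -
  have \<nu>': "bounded_vector_measure (\<lambda>A. - \<nu> A)"
    by (rule bounded_vector_measure_uminus[OF \<nu>])
  show ?thesis
    using norm_le_enn2real_variation[OF \<nu> A]
      emeasure_positive_part[OF \<nu> A] emeasure_positive_part[OF \<nu>' A]
    by (simp add: measure_def variation_uminus abs_le_iff field_simps)
qed

section \<open>The integral is bounded by the total variation\<close>

lemma integral_simple:
  fixes s :: "'a \<Rightarrow> complex"
  assumes "finite_measure M" "simple_function M s" "space M = UNIV"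
  shows "integral\<^sup>L M s = (\<Sum>y\<in>range s. of_real (measure M (s -` {y})) * y)"
proof -
  interpret finite_measure M by fact
  have fin: "finite (range s)" using simple_functionD(1)[OF assms(2)] assms(3) by simp
  have S: "s -` {y} \<in> sets M" for y
    using simple_functionD(2)[OF assms(2), of "{y}"] assms(3) by simp
  have "(\<Sum>y\<in>range s. indicator (s -` {y}) x *\<^sub>R y) = (\<Sum>y\<in>range s. if y = s x then y else 0)" for x
    by (intro sum.cong) (auto simp: indicator_def)
  then have "s = (\<lambda>x. \<Sum>y\<in>range s. indicator (s -` {y}) x *\<^sub>R y)"
    using fin by simp
  then have "integral\<^sup>L M s = integral\<^sup>L M (\<lambda>x. \<Sum>y\<in>range s. indicator (s -` {y}) x *\<^sub>R y)"
    by simp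
  also have "\<dots> = (\<Sum>y\<in>range s. integral\<^sup>L M (\<lambda>x. indicator (s -` {y}) x *\<^sub>R y))"
    using S by (intro Bochner_Integration.integral_sum) (auto simp: less_top[symmetric] integrable_indicator_iff)
  also have "\<dots> = (\<Sum>y\<in>range s. of_real (measure M (s -` {y})) * y)"
    using S by (intro sum.cong) (auto simp: scaleR_conv_of_real less_top[symmetric])
  finally show ?thesis .
qed

lemma signed_integral_simple:
  assumes \<nu>: "bounded_vector_measure \<nu>" and s: "simple_function borel s"
  shows "signed_integral \<nu> s = (\<Sum>y\<in>range s. of_real (\<nu> (s -` {y})) * y)"
proof -
  have \<nu>': "bounded_vector_measure (\<lambda>A. - \<nu> A)"
    by (rule bounded_vector_measure_uminus[OF \<nu>])
  have s': "simple_function (positive_part \<nu>) s" for \<nu> :: "'a set \<Rightarrow> real"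
    using s by (simp add: simple_function_def)
  have S: "s -` {y} \<in> sets borel" for y
    using simple_functionD(2)[OF s, of "{y}"] by simp
  show ?thesis
    unfolding signed_integral_def integral_simple[OF finite_positive_part[OF \<nu>] s' space_positive_part]
      integral_simple[OF finite_positive_part[OF \<nu>'] s' space_positive_part]
    by (simp flip: sum_subtractf left_diff_distrib of_real_diff add: measure_positive_part_diff[OF \<nu> S])
qed

lemma bounded_vector_measure_Re: "bounded_vector_measure \<mu> \<Longrightarrow> bounded_vector_measure (\<lambda>A. Re (\<mu> A))"
  by (erule bounded_vector_measure_contraction[OF _ bounded_linear_Re]) (simp add: abs_Re_le_cmod)

lemma bounded_vector_measure_Im: "bounded_vector_measure \<mu> \<Longrightarrow> bounded_vector_measure (\<lambda>A. Im (\<mu> A))"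
  by (erule bounded_vector_measure_contraction[OF _ bounded_linear_Im]) (simp add: abs_Im_le_cmod)

text \<open>On simple functions the four positive measures recombine to \<open>\<mu>\<close> itself. This is what makes the
  sharp bound possible: estimating the real and the imaginary part separately would lose a constant.\<close>

lemma complex_integral_simple:
  assumes \<mu>: "bounded_vector_measure \<mu>" and s: "simple_function borel s"
  shows "complex_integral \<mu> s = (\<Sum>y\<in>range s. \<mu> (s -` {y}) * y)"
proof -
  have "of_real (Re z) * y + \<i> * (of_real (Im z) * y) = z * y" for y z :: complex
    by (simp add: complex_eq_iff)
  then show ?thesis
    unfolding complex_integral_def
      signed_integral_simple[OF bounded_vector_measure_Re[OF \<mu>] s]
      signed_integral_simple[OF bounded_vector_measure_Im[OF \<mu>] s]
      sum_distrib_left sum.distrib[symmetric] by (intro sum.cong) auto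
qed

text \<open>The level sets of a simple function form a finite partition of the space, and the variation is
  additive over it.\<close>

lemma finite_partition_sum_le_tv_norm:
  assumes \<mu>: "bounded_vector_measure \<mu>" and s: "simple_function borel s"
  shows "(\<Sum>y\<in>range s. cmod (\<mu> (s -` {y}))) \<le> tv_norm \<mu>"
proof -
  have fin: "finite (range s)" using simple_functionD(1)[OF s] by simp
  have S: "s -` {y} \<in> sets borel" for y
    using simple_functionD(2)[OF s, of "{y}"] by simp
  interpret V: finite_measure "variation_measure \<mu>" by (rule finite_variation_measure[OF \<mu>])
  note var = measure_variation_measure[OF \<mu>, symmetric]
  have "(\<Sum>y\<in>range s. cmod (\<mu> (s -` {y}))) \<le> (\<Sum>y\<in>range s. measure (variation_measure \<mu>) (s -` {y}))"
  proof (rule sum_mono)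
    fix y
    show "cmod (\<mu> (s -` {y})) \<le> measure (variation_measure \<mu>) (s -` {y})"
      using norm_le_enn2real_variation[OF \<mu> S] by (simp add: var[OF S])
  qed
  also have "\<dots> = measure (variation_measure \<mu>) (\<Union>y\<in>range s. s -` {y})"
    using S fin by (intro V.finite_measure_finite_Union[symmetric]) (auto simp: disjoint_family_on_def)
  also have "(\<Union>y\<in>range s. s -` {y}) = UNIV" by auto
  also have "measure (variation_measure \<mu>) UNIV = tv_norm \<mu>" by (simp add: tv_norm_def var)
  finally show ?thesis .
qed

lemma signed_integral_dominated_convergence:
  assumes \<nu>: "bounded_vector_measure \<nu>"
    and meas: "\<And>n. t n \<in> borel_measurable borel" "f \<in> borel_measurable borel"
    and bound: "\<And>n x. cmod (t n x) \<le> C" and lim: "\<And>x. (\<lambda>n. t n x) \<longlonglongrightarrow> f x"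
  shows "(\<lambda>n. signed_integral \<nu> (t n)) \<longlonglongrightarrow> signed_integral \<nu> f"
proof -
  have conv: "(\<lambda>n. integral\<^sup>L (positive_part \<nu>) (t n)) \<longlonglongrightarrow> integral\<^sup>L (positive_part \<nu>) f"
    if "bounded_vector_measure \<nu>" for \<nu> :: "'a set \<Rightarrow> real"
  proof -
    interpret finite_measure "positive_part \<nu>" by (rule finite_positive_part[OF that])
    show ?thesis
      by (rule integral_dominated_convergence[where w = "\<lambda>_. C"]) (use meas bound lim in auto)
  qed
  have \<nu>': "bounded_vector_measure (\<lambda>A. - \<nu> A)"
    by (rule bounded_vector_measure_uminus[OF \<nu>])
  show ?thesis
    unfolding signed_integral_def by (intro tendsto_diff conv \<nu> \<nu>')
qed

text \<open>For a simple function bounded by 1, the integral is bounded by a partition sum of the total variation.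
  The general case follows by dominated convergence.\<close>

lemma norm_complex_integral_le:
  assumes \<mu>: "bounded_vector_measure \<mu>" and f: "f \<in> borel_measurable borel" and f1: "\<And>x. cmod (f x) \<le> 1"
  shows "cmod (complex_integral \<mu> f) \<le> tv_norm \<mu>"
proof -
  obtain s where s: "\<And>n. simple_function borel (s n)" and lim: "\<And>x. (\<lambda>n. s n x) \<longlonglongrightarrow> f x"
    using borel_measurable_implies_sequence_metric[OF f, of 0] by auto
  \<comment> \<open>The approximating simple functions may exceed 1 in modulus, which would spoil the constant, so
    their values are first moved into the unit disc; this leaves the limit unchanged.\<close>
  define t where "t n x = s n x / of_real (max 1 (cmod (s n x)))" for n x
  have t: "simple_function borel (t n)" for n
    unfolding t_def by (rule simple_function_compose1[OF s])
  have t1: "cmod (t n x) \<le> 1" for n x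
    by (auto simp: t_def norm_divide divide_simps)
  have tlim: "(\<lambda>n. t n x) \<longlonglongrightarrow> f x" for x
  proof -
    have "(\<lambda>n. t n x) \<longlonglongrightarrow> f x / of_real (max 1 (cmod (f x)))"
      unfolding t_def by (intro tendsto_intros lim) auto
    then show ?thesis using f1[of x] by (simp add: max_absorb1)
  qed
  have tm: "t n \<in> borel_measurable borel" for n
    using borel_measurable_simple_function[OF t] .
  have "(\<lambda>n. complex_integral \<mu> (t n)) \<longlonglongrightarrow> complex_integral \<mu> f"
    unfolding complex_integral_def
    by (intro tendsto_intros signed_integral_dominated_convergence[OF _ tm f t1 tlim]
         bounded_vector_measure_Re bounded_vector_measure_Im \<mu>)
  then have "(\<lambda>n. cmod (complex_integral \<mu> (t n))) \<longlonglongrightarrow> cmod (complex_integral \<mu> f)"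
    by (rule tendsto_norm)
  moreover have "cmod (complex_integral \<mu> (t n)) \<le> tv_norm \<mu>" for n
  proof -
    have "cmod (complex_integral \<mu> (t n)) \<le> (\<Sum>y\<in>range (t n). cmod (\<mu> (t n -` {y}) * y))"
      unfolding complex_integral_simple[OF \<mu> t] by (rule norm_sum)
    also have "\<dots> \<le> (\<Sum>y\<in>range (t n). cmod (\<mu> (t n -` {y})))"
      using t1 by (intro sum_mono) (auto simp: norm_mult intro: mult_left_le)
    also have "\<dots> \<le> tv_norm \<mu>" by (rule finite_partition_sum_le_tv_norm[OF \<mu> t])
    finally show ?thesis .
  qed
  ultimately show ?thesis by (intro LIMSEQ_le_const2) auto
qed

section \<open>Characters\<close>

text \<open>Scaling and conjugation commute with each of the four Bochner integrals; an integral that does not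
  exist is 0 on both sides.\<close>

lemma complex_integral_cnj_cmult:
  "complex_integral (\<lambda>A. cnj (\<mu> A)) (\<lambda>x. c * cnj (f x)) = c * cnj (complex_integral \<mu> f)"
proof -
  have 1: "signed_integral \<nu> (\<lambda>x. c * cnj (f x)) = c * cnj (signed_integral \<nu> f)" for \<nu> :: "'a set \<Rightarrow> real"
    by (simp add: signed_integral_def right_diff_distrib)
  have 2: "signed_integral (\<lambda>A. - \<nu> A) g = - signed_integral \<nu> g" for \<nu> :: "'a set \<Rightarrow> real" and g
    by (simp add: signed_integral_def)
  show ?thesis
    unfolding complex_integral_def by (simp add: 1 2 algebra_simps)
qed

lemma character_uminus: "character (- m) x = cnj (character m x)"
  unfolding character_def by (simp add: exp_cnj sum_negf)

lemma norm_character [simp]: "cmod (character m x) = 1"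
proof -
  have "character m x = exp (\<i> * of_real (2 * pi * (\<Sum>i\<in>UNIV. of_int (m $ i) * rep_circle (x $ i))))"
    unfolding character_def by (simp add: mult_ac)
  then show ?thesis by (simp only: norm_exp_i_times)
qed

text \<open>Pairing with a character is conjugate to integrating against the conjugate character.\<close>

lemma pairing_character:
  "pairing (\<lambda>x. c * character m x) \<mu> = c * cnj (fourier_coeff \<mu> m)"
  using complex_integral_cnj_cmult[of \<mu> c "character (- m)"]
  by (simp add: pairing_def fourier_coeff_def character_uminus)

text \<open>\<^const>\<open>rep_circle\<close> is not continuous, but the exponential does not depend on the representative, so
  its pullback to the reals is the usual exponential and the quotient topology gives continuity.\<close>

lemma continuous_on_circle_exp:
  "continuous_on UNIV (\<lambda>c. exp (2 * pi * \<i> * (of_int k * of_real (rep_circle c))))"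
proof -
  have eq: "exp (2 * pi * \<i> * (of_int k * of_real (rep_circle (abs_circle t))))
    = exp (2 * pi * \<i> * (of_int k * of_real t))" for t
    using character_abs_circle[of "\<chi> i::unit. k" "\<chi> i. t"]
    by (simp add: character_def UNIV_unit)
  show ?thesis
    unfolding continuous_on_open_vimage[OF open_UNIV]
  proof (intro allI impI)
    fix B :: "complex set" assume "open B"
    have "open ((\<lambda>t. exp (2 * pi * \<i> * (of_int k * of_real t)) :: complex) -` B)"
      using \<open>open B\<close> by (rule open_vimage) (intro continuous_intros)
    then show "open ((\<lambda>c. exp (2 * pi * \<i> * (of_int k * of_real (rep_circle c)))) -` B \<inter> UNIV)"
      by (simp add: open_circle_def vimage_def eq[simplified])
  qed
qed

lemma continuous_character: "continuous_on UNIV (character m)"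
proof -
  have "character m x = (\<Prod>i\<in>UNIV. exp (2 * pi * \<i> * (of_int (m $ i) * of_real (rep_circle (x $ i)))))" for x
    unfolding character_def by (simp add: sum_distrib_left exp_sum)
  moreover have "continuous_on UNIV (\<lambda>x. exp (2 * pi * \<i> * (of_int (m $ i) * of_real (rep_circle (x $ i)))))"
    for i and m :: "int ^ 'a"
    by (rule continuous_on_compose2[OF continuous_on_circle_exp])
       (auto simp: continuous_on_def intro!: tendsto_intros)
  ultimately show ?thesis
    by (simp add: continuous_on_prod cong: continuous_on_cong)
qed

section \<open>Trigonometric polynomials of constant modulus\<close>

text \<open>Take \<open>v\<close> to consist of distinct powers of an integer \<open>N\<close>. The inner product of \<open>m\<close> with \<open>v\<close> is then the
  value at \<open>N\<close> of a nonzero polynomial with the entries of \<open>m\<close> as coefficients, so only finitely many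
  \<open>N\<close> fail.\<close>

lemma separating_direction:
  fixes D :: "(int ^ 'd::finite) set"
  assumes "finite D" "0 \<notin> D"
  shows "\<exists>v :: int ^ 'd. \<forall>m\<in>D. (\<Sum>i\<in>UNIV. m $ i * v $ i) \<noteq> 0"
proof -
  obtain h :: "'d \<Rightarrow> nat" where h: "inj h"
    using finite_imp_inj_to_nat_seg[of "UNIV :: 'd set"] by auto
  define p where "p m = (\<Sum>i\<in>UNIV. monom (m $ i) (h i))" for m :: "int ^ 'd"
  have "p m \<noteq> 0" if "m \<in> D" for m
  proof -
    have "m \<noteq> 0" using that assms(2) by metis
    then obtain j where j: "m $ j \<noteq> 0" by (auto simp: vec_eq_iff)
    have "coeff (p m) (h j) = m $ j"
      unfolding p_def by (simp add: coeff_sum inj_eq[OF h])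
    then show ?thesis using j by auto
  qed
  then have "finite (\<Union>m\<in>D. {x. poly (p m) x = 0})"
    using assms(1) by (auto intro: poly_roots_finite)
  then obtain N where N: "N \<notin> (\<Union>m\<in>D. {x. poly (p m) x = 0})"
    using ex_new_if_finite[OF infinite_UNIV_int] by blast
  have "poly (p m) N = (\<Sum>i\<in>UNIV. m $ i * N ^ h i)" for m
    by (simp add: p_def poly_sum poly_monom)
  then show ?thesis using N by (intro exI[of _ "\<chi> i. N ^ h i"]) auto
qed

text \<open>On the unit circle the sum \<open>g\<close> satisfies \<open>g(z) * cnj (g(z)) = 1\<close>. Let \<open>k l\<close> and \<open>k u\<close> be the lowest and
  the highest frequency. Clearing negative powers turns the equation into a polynomial identity
  \<open>P * Q = z ^ n\<close> with \<open>n = k u - k l\<close>, valid at infinitely many points and so everywhere.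
  At \<open>z = 0\<close> the left side is \<open>a l * cnj (a u)\<close>, which is nonzero, and this forces \<open>n = 0\<close>.\<close>

lemma unimodular_exponential_sum:
  fixes k :: "'a \<Rightarrow> int" and a :: "'a \<Rightarrow> complex"
  assumes fin: "finite S" and inj: "inj_on k S" and nz: "\<And>m. m \<in> S \<Longrightarrow> a m \<noteq> 0"
    and uni: "\<And>t. cmod (\<Sum>m\<in>S. a m * cis (of_int (k m) * t)) = 1"
  shows "\<exists>m. S = {m}"
proof -
  have "S \<noteq> {}" using uni[of 0] by auto
  obtain l where l: "l \<in> S" "\<And>m. m \<in> S \<Longrightarrow> k l \<le> k m"
    using ex_is_arg_min_if_finite[OF fin \<open>S \<noteq> {}\<close>, of k] by (auto simp: is_arg_min_linorder)
  obtain u where u: "u \<in> S" "\<And>m. m \<in> S \<Longrightarrow> k m \<le> k u"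
    using ex_is_arg_min_if_finite[OF fin \<open>S \<noteq> {}\<close>, of "\<lambda>m. - k m"] by (auto simp: is_arg_min_linorder)
  define P where "P = (\<Sum>m\<in>S. monom (a m) (nat (k m - k l)))"
  define Q where "Q = (\<Sum>m\<in>S. monom (cnj (a m)) (nat (k u - k m)))"
  define n where "n = nat (k u - k l)"
  have root: "poly (P * Q - monom 1 n) (cis x) = 0" for x
  proof -
    define g where "g = (\<Sum>m\<in>S. a m * cis (of_int (k m) * x))"
    have cis_pow: "cis x ^ nat j = cis (of_int j * x)" if "0 \<le> j" for j
      using that by (simp only: Complex.DeMoivre of_nat_nat)
    have "poly P (cis x) = g * cis (- of_int (k l) * x)"
      unfolding P_def g_def poly_sum sum_distrib_right
      by (intro sum.cong) (auto simp: poly_monom cis_pow cis_mult left_diff_distrib l(2) mult.assoc)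
    moreover have "poly Q (cis x) = cnj g * cis (of_int (k u) * x)"
      unfolding Q_def g_def poly_sum sum_distrib_right cnj_sum
      by (intro sum.cong) (auto simp: poly_monom cis_pow cis_mult left_diff_distrib u(2) cis_cnj mult.assoc)
    moreover have "g * cnj g = 1"
      using uni[of x] complex_norm_square[of g] by (simp add: g_def)
    moreover have "cis (- of_int (k l) * x) * cis (of_int (k u) * x) = cis x ^ n"
      using l u by (simp add: cis_pow cis_mult n_def left_diff_distrib)
    ultimately show ?thesis by (simp add: poly_monom mult_ac)
  qed
  have "P * Q - monom 1 n = 0"
  proof (rule ccontr)
    assume "P * Q - monom 1 n \<noteq> 0"
    then have "finite {z. poly (P * Q - monom 1 n) z = 0}" by (rule poly_roots_finite)
    moreover have "cis ` {0<..<1} \<subseteq> {z. poly (P * Q - monom 1 n) z = 0}" using root by auto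
    \<comment> \<open>Any infinite set of points of the circle will do. The cosine is injective on this interval.\<close>
    moreover have "inj_on cis {0<..<1}"
    proof (rule inj_onI)
      fix x y :: real assume xy: "x \<in> {0<..<1}" "y \<in> {0<..<1}" and "cis x = cis y"
      then have "cos x = cos y" by (metis cis.sel(1))
      then show "x = y" using xy pi_gt3
        by (intro cos_inj_pi[of x y]; simp)
    qed
    moreover have "infinite {0<..<1::real}" by (simp add: infinite_Ioo)
    ultimately show False using finite_imageD finite_subset by metis
  qed
  then have PQ: "poly P 0 * poly Q 0 = 0 ^ n"
    by (metis eq_iff_diff_eq_0 mult_1 poly_monom poly_mult)
  have "poly P 0 = (\<Sum>m\<in>S. if m = l then a m else 0)"
    unfolding P_def poly_sum
  proof (intro sum.cong refl)
    fix m assume "m \<in> S"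
    then have "nat (k m - k l) = 0 \<longleftrightarrow> m = l"
      using l inj by (force dest: inj_onD)
    then show "poly (monom (a m) (nat (k m - k l))) 0 = (if m = l then a m else 0)"
      by (simp add: poly_monom power_0_left)
  qed
  moreover have "poly Q 0 = (\<Sum>m\<in>S. if m = u then cnj (a m) else 0)"
    unfolding Q_def poly_sum
  proof (intro sum.cong refl)
    fix m assume "m \<in> S"
    then have "nat (k u - k m) = 0 \<longleftrightarrow> m = u"
      using u inj by (force dest: inj_onD)
    then show "poly (monom (cnj (a m)) (nat (k u - k m))) 0 = (if m = u then cnj (a m) else 0)"
      by (simp add: poly_monom power_0_left)
  qed
  moreover have "a l * cnj (a u) \<noteq> 0" using nz l(1) u(1) by simp
  ultimately have "poly P 0 * poly Q 0 \<noteq> 0"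
    using fin l(1) u(1) by simp
  then have "n = 0" unfolding PQ by (cases n) simp_all
  then have "k u = k l" using l(2)[OF u(1)] by (simp add: n_def)
  have "m = l" if "m \<in> S" for m
  proof (rule inj_onD[OF inj])
    show "k m = k l" using l(2)[OF that] u(2)[OF that] \<open>k u = k l\<close> by simp
  qed (use that l(1) in auto)
  then have "S = {l}" using l(1) by blast
  then show ?thesis ..
qed

text \<open>Restricting to the closed geodesic \<open>t \<mapsto> t * v\<close>, with \<open>v\<close> chosen such that distinct frequencies stay
  distinct, reduces the claim to one variable.\<close>

lemma unimodular_trig_poly_monomial:
  fixes \<Lambda> :: "(int ^ 'd::finite) set"
  assumes "finite \<Lambda>" and uni: "\<And>x. cmod (\<Sum>m\<in>\<Lambda>. a m * character m x) = 1"
  shows "\<exists>l\<in>\<Lambda>. (\<forall>x. (\<Sum>m\<in>\<Lambda>. a m * character m x) = a l * character l x) \<and> cmod (a l) = 1"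
proof -
  define S where "S = {m \<in> \<Lambda>. a m \<noteq> 0}"
  have S: "(\<Sum>m\<in>\<Lambda>. a m * b m) = (\<Sum>m\<in>S. a m * b m)" for b
    unfolding S_def using assms(1) by (intro sum.mono_neutral_right) auto
  have fin: "finite S" using assms(1) by (simp add: S_def)
  obtain v :: "int ^ 'd" where
    v: "\<And>d. d \<in> (\<lambda>(m, m'). m - m') ` (S \<times> S) - {0} \<Longrightarrow> (\<Sum>i\<in>UNIV. d $ i * v $ i) \<noteq> 0"
    using separating_direction[of "(\<lambda>(m, m'). m - m') ` (S \<times> S) - {0}"] fin by auto
  define k where "k m = (\<Sum>i\<in>UNIV. m $ i * v $ i)" for m :: "int ^ 'd"
  have "inj_on k S"
  proof (rule inj_onI, rule ccontr)
    fix m m' assume "m \<in> S" "m' \<in> S" "k m = k m'" "m \<noteq> m'"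
    then show False using v[of "m - m'"]
      by (force simp: k_def left_diff_distrib sum_subtractf)
  qed
  moreover have "a m \<noteq> 0" if "m \<in> S" for m using that by (simp add: S_def)
  moreover have "cmod (\<Sum>m\<in>S. a m * cis (of_int (k m) * t)) = 1" for t
  proof -
    have "character m (\<chi> i. abs_circle (of_int (v $ i) * (t / (2 * pi)))) = cis (of_int (k m) * t)" for m
      using character_abs_circle[of m "\<chi> i. of_int (v $ i) * (t / (2 * pi))"]
      by (simp add: cis_conv_exp k_def sum_distrib_left sum_distrib_right mult_ac)
    then show ?thesis using uni[of "\<chi> i. abs_circle (of_int (v $ i) * (t / (2 * pi)))"] by (simp add: S)
  qed
  ultimately have "\<exists>l. S = {l}" by (rule unimodular_exponential_sum[OF fin])
  then obtain l where l: "S = {l}" ..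
  have eq: "(\<Sum>m\<in>\<Lambda>. a m * character m x) = a l * character l x" for x
    by (simp add: S l)
  have "cmod (a l) = 1" using uni[of undefined] by (simp add: eq norm_mult)
  moreover have "l \<in> \<Lambda>" using l by (auto simp: S_def)
  ultimately show ?thesis using eq by blast
qed

section \<open>Fourier coefficients and minimal extrapolation\<close>

lemma norm_fourier_coeff_le_tv_norm:
  assumes "\<nu> \<in> radon_measures"
  shows "cmod (fourier_coeff \<nu> m) \<le> tv_norm \<nu>"
  unfolding fourier_coeff_def
  by (rule norm_complex_integral_le[OF radon_imp_bounded_vector_measure[OF assms]])
     (simp_all add: borel_measurable_continuous_onI continuous_character)

text \<open>Every competitor in the infimum has the same Fourier coefficients on \<open>\<Lambda>\<close> as \<open>\<mu>\<close>.\<close>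

lemma norm_fourier_coeff_le_min_norm:
  assumes "\<mu> \<in> radon_measures" "m \<in> \<Lambda>"
  shows "cmod (fourier_coeff \<mu> m) \<le> min_norm \<mu> \<Lambda>"
  unfolding min_norm_def
proof (rule cInf_greatest)
  show "{tv_norm \<nu> |\<nu>. \<nu> \<in> radon_measures \<and> (\<forall>m\<in>\<Lambda>. fourier_coeff \<nu> m = fourier_coeff \<mu> m)} \<noteq> {}"
    using assms(1) by blast
next
  fix r
  assume "r \<in> {tv_norm \<nu> |\<nu>. \<nu> \<in> radon_measures \<and> (\<forall>m\<in>\<Lambda>. fourier_coeff \<nu> m = fourier_coeff \<mu> m)}"
  then obtain \<nu> where "\<nu> \<in> radon_measures" "fourier_coeff \<nu> m = fourier_coeff \<mu> m" "r = tv_norm \<nu>"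
    using assms(2) by blast
  then show "cmod (fourier_coeff \<mu> m) \<le> r"
    using norm_fourier_coeff_le_tv_norm by metis
qed

theorem proposition2p6:
  fixes \<mu> :: "('d::finite) torus set \<Rightarrow> complex" and \<Lambda> :: "(int ^ 'd) set"
  assumes "\<mu> \<in> radon_measures"
    and "finite \<Lambda>"
    and "\<exists>\<phi> \<in> trig_polys_unit \<Lambda>.
           (\<forall>x. cmod (\<phi> x) = 1) \<and> pairing \<phi> \<mu> = complex_of_real (min_norm \<mu> \<Lambda>)"
  shows "extremal_freqs \<mu> \<Lambda> \<noteq> {} \<and> min_norm \<mu> \<Lambda> = linf_norm \<Lambda> (fourier_coeff \<mu>)"
proof -
  obtain a where uni: "\<And>x. cmod (\<Sum>m\<in>\<Lambda>. a m * character m x) = 1"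
    and pair: "pairing (\<lambda>x. \<Sum>m\<in>\<Lambda>. a m * character m x) \<mu> = complex_of_real (min_norm \<mu> \<Lambda>)"
    using assms(3) by (auto simp: trig_polys_unit_def)
  obtain l where l: "l \<in> \<Lambda>" "cmod (a l) = 1"
    and mono: "\<And>x. (\<Sum>m\<in>\<Lambda>. a m * character m x) = a l * character l x"
    using unimodular_trig_poly_monomial[OF assms(2) uni] by blast
  have le: "cmod (fourier_coeff \<mu> m) \<le> min_norm \<mu> \<Lambda>" if "m \<in> \<Lambda>" for m
    using norm_fourier_coeff_le_min_norm[OF assms(1) that] .
  have "0 \<le> min_norm \<mu> \<Lambda>"
    using le[OF l(1)] norm_ge_zero order_trans by blast
  moreover have "a l * cnj (fourier_coeff \<mu> l) = complex_of_real (min_norm \<mu> \<Lambda>)"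
    using pair by (simp only: mono pairing_character)
  then have "cmod (fourier_coeff \<mu> l) = \<bar>min_norm \<mu> \<Lambda>\<bar>"
    using l(2) by (metis complex_mod_cnj mult_1 norm_mult norm_of_real)
  ultimately have eq: "cmod (fourier_coeff \<mu> l) = min_norm \<mu> \<Lambda>" by simp
  have "linf_norm \<Lambda> (fourier_coeff \<mu>) = min_norm \<mu> \<Lambda>"
    unfolding linf_norm_def
  proof (rule cSup_eq_maximum)
    show "min_norm \<mu> \<Lambda> \<in> (\<lambda>m. cmod (fourier_coeff \<mu> m)) ` \<Lambda>"
      by (rule image_eqI, rule eq[symmetric], rule l(1))
  qed (use le in auto)
  moreover have "l \<in> extremal_freqs \<mu> \<Lambda>"
    using l(1) eq by (simp add: extremal_freqs_def)
  ultimately show ?thesis by auto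
qed

end
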